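(* Let $A$ and $B$ be unital C$^*$-algebras with $B$ finite, and let $\varphi,\psi:A\to B$ be bounded linear maps such that $\varphi(a)\psi(b)=0$ whenever $a,b\in A$ satisfy $ab=0$. Suppose that both $\varphi(A)$ and $\psi(A)$ contain invertible elements. Then there exists an (algebra) homomorphism $\rho:A\to B$ such that $\varphi(a)=\varphi(1)\rho(a)$ and $\psi(a)=\rho(a)\psi(1)$ for all $a\in A$.
   Context: A unital C$^*$-algebra $B$ is finite if it is Dedekind-finite, i.e. every one-sided invertible element of $B$ is invertible. *)

theory Defs
  imports Complex_Main
begin

class cstar_algebra = real_normed_algebra_1 + banach +
  fixes scaleC :: "complex \<Rightarrow> 'a \<Rightarrow> 'a"
    and adj :: "'a \<Rightarrow> 'a"
  assumes scaleC_add_right: "scaleC c (x + y) = scaleC c x + scaleC c y"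
    and scaleC_add_left: "scaleC (c + d) x = scaleC c x + scaleC d x"
    and scaleC_scaleC: "scaleC c (scaleC d x) = scaleC (c * d) x"
    and scaleC_one: "scaleC 1 x = x"
    and scaleR_scaleC: "scaleR r x = scaleC (of_real r) x"
    and norm_scaleC: "norm (scaleC c x) = cmod c * norm x"
    and scaleC_mult_left: "scaleC c x * y = scaleC c (x * y)"
    and scaleC_mult_right: "x * scaleC c y = scaleC c (x * y)"
    and adj_adj: "adj (adj x) = x"
    and adj_add: "adj (x + y) = adj x + adj y"
    and adj_scaleC: "adj (scaleC c x) = scaleC (cnj c) (adj x)"
    and adj_mult: "adj (x * y) = adj y * adj x"
    and cstar_identity: "norm (adj x * x) = norm x * norm x"

definition invertible_elem :: "'a::ring_1 \<Rightarrow> bool" where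
  "invertible_elem x \<longleftrightarrow> (\<exists>y. x * y = 1 \<and> y * x = 1)"

definition dedekind_finite :: "('a::ring_1) itself \<Rightarrow> bool" where
  "dedekind_finite (_::('a::ring_1) itself) \<longleftrightarrow>
     (\<forall>x y::'a. x * y = 1 \<longrightarrow> y * x = 1)"

definition bounded_clinear_map :: "('a::cstar_algebra \<Rightarrow> 'b::cstar_algebra) \<Rightarrow> bool" where
  "bounded_clinear_map f \<longleftrightarrow>
     (\<forall>x y. f (x + y) = f x + f y) \<and>
     (\<forall>c x. f (scaleC c x) = scaleC c (f x)) \<and>
     (\<exists>K. \<forall>x. norm (f x) \<le> norm x * K)"

definition algebra_hom :: "('a::cstar_algebra \<Rightarrow> 'b::cstar_algebra) \<Rightarrow> bool" where
  "algebra_hom f \<longleftrightarrow>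
     (\<forall>x y. f (x + y) = f x + f y) \<and>
     (\<forall>c x. f (scaleC c x) = scaleC c (f x)) \<and>
     (\<forall>x y. f (x * y) = f x * f y)"

end

theory Submission
  imports Defs "HOL-Complex_Analysis.Complex_Analysis"
begin

text \<open>Everything follows from the identity \<open>\<phi>(ab) \<psi>(c) = \<phi>(a) \<psi>(bc)\<close>: it gives
  \<open>\<phi>(a) \<psi>(b) = \<phi>(1) \<psi>(ab) = \<phi>(ab) \<psi>(1)\<close>, so \<open>\<phi>(1)\<close> and \<open>\<psi>(1)\<close> are one-sided invertible, hence
  invertible, and \<open>\<rho> = \<phi>(1)\<^sup>-\<^sup>1 \<phi>\<close> works.

  For fixed \<open>a\<close> and \<open>c\<close> the bilinear map \<open>V(x, y) = \<phi>(ax) \<psi>(yc)\<close> vanishes whenever \<open>xy = 0\<close>, and the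
  identity says \<open>V(b, 1) = V(1, b)\<close>. For unitary \<open>b\<close> this is shown with a contractive functional
  calculus for continuous functions on the unit circle: a function \<open>k\<close> with values in \<open>[0, 1]\<close> is cut
  into \<open>n\<close> overlapping pieces, and the zero product condition bounds \<open>V(nk, 1) - V(1, nk)\<close>
  independently of \<open>n\<close>. Differentiating at \<open>t = 0\<close> along the unitaries \<open>exp(tx)\<close> with \<open>x\<close>
  skew-adjoint gives the identity for all \<open>x\<close>, and these span the algebra.\<close>

section \<open>Scalars, adjoints and norms in a C*-algebra\<close>

lemma scaleC_zero_left [simp]: "scaleC 0 x = (0::'a::cstar_algebra)"
  using scaleC_add_left[of 0 0 x] by simp

lemma scaleC_zero_right [simp]: "scaleC c (0::'a::cstar_algebra) = 0"
  using scaleC_add_right[of c 0 "0::'a"] by simp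

lemma scaleC_minus_left: "scaleC (- c) x = - scaleC c x" for x :: "'a::cstar_algebra"
  using scaleC_add_left[of c "- c" x] by (simp add: eq_neg_iff_add_eq_0 add.commute)

lemma norm_le_norm_adj: "norm x \<le> norm (adj x)" for x :: "'a::cstar_algebra"
proof (cases "x = 0")
  case False
  have "norm x * norm x \<le> norm (adj x) * norm x"
    using norm_mult_ineq[of "adj x" x] by (simp add: cstar_identity)
  with False show ?thesis by simp
qed simp

lemma norm_adj [simp]: "norm (adj x) = norm x" for x :: "'a::cstar_algebra"
  using norm_le_norm_adj[of x] norm_le_norm_adj[of "adj x"] by (simp add: adj_adj)

lemma adj_one [simp]: "adj 1 = (1::'a::cstar_algebra)"
  by (metis adj_adj adj_mult mult_1_right mult_1_left)

lemma bounded_linear_adj: "bounded_linear (adj :: 'a::cstar_algebra \<Rightarrow> 'a)"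
  by (rule bounded_linear_intro[where K = 1])
     (auto simp: adj_add scaleR_scaleC adj_scaleC)

lemma adj_power: "adj (x ^ n) = adj x ^ n" for x :: "'a::cstar_algebra"
  by (induction n) (simp_all add: adj_mult power_commutes)

text \<open>For normal \<open>x\<close>, the C*-identity applied to \<open>x\<^sup>2\<close> and to
  \<open>adj x * x\<close> gives norm of the square = square of the norm. Squares of normal elements
  are normal, so each induction step doubles the exponent.\<close>

lemma norm_power_normal:
  fixes x :: "'a::cstar_algebra"
  assumes "adj x * x = x * adj x"
  shows "norm (x ^ 2 ^ n) = norm x ^ 2 ^ n"
  using assms
proof (induction n arbitrary: x)
  case (Suc n)
  let ?y = "adj x * x"
  have "norm (x\<^sup>2) * norm (x\<^sup>2) = norm (adj (x\<^sup>2) * x\<^sup>2)"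
    by (simp add: cstar_identity)
  also have "adj (x\<^sup>2) * x\<^sup>2 = adj ?y * ?y"
    using Suc.prems by (simp add: power2_eq_square adj_mult adj_adj mult.assoc) (metis mult.assoc)
  also have "norm \<dots> = (norm x)\<^sup>2 * (norm x)\<^sup>2"
    by (simp add: cstar_identity power2_eq_square)
  finally have *: "norm (x\<^sup>2) = (norm x)\<^sup>2"
    by (metis abs_of_nonneg norm_ge_zero power2_eq_square real_sqrt_abs zero_le_power2)
  have "adj (x\<^sup>2) * x\<^sup>2 = x\<^sup>2 * adj (x\<^sup>2)"
    using Suc.prems by (simp add: power2_eq_square adj_mult mult.assoc) (metis mult.assoc)
  from Suc.IH[OF this] show ?case
    by (simp add: * flip: power_mult)
qed simp

section \<open>Polynomials in an algebra element\<close>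

definition poly_calc :: "'a::cstar_algebra \<Rightarrow> complex poly \<Rightarrow> 'a" where
  "poly_calc u p = fold_coeffs (\<lambda>a y. scaleC a 1 + u * y) p 0"

lemma poly_calc_0 [simp]: "poly_calc u 0 = 0"
  by (simp add: poly_calc_def)

lemma poly_calc_pCons [simp]: "poly_calc u (pCons a p) = scaleC a 1 + u * poly_calc u p"
  \<comment> \<open>\<open>pCons 0 0\<close> is \<open>0\<close>, so it adds no step to the fold and
    needs its own case.\<close>
  by (cases "p = 0 \<and> a = 0") (auto simp: poly_calc_def)

lemma poly_calc_1 [simp]: "poly_calc u 1 = 1"
  by (simp add: one_pCons scaleC_one)

lemma poly_calc_add: "poly_calc u (p + q) = poly_calc u p + poly_calc u q"
  by (induction p q rule: poly_induct2) (simp_all add: scaleC_add_left distrib_left)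

lemma poly_calc_smult: "poly_calc u (smult c p) = scaleC c (poly_calc u p)"
  by (induction p) (simp_all add: scaleC_add_right scaleC_scaleC scaleC_mult_right)

lemma poly_calc_mult: "poly_calc u (p * q) = poly_calc u p * poly_calc u q"
  by (induction p)
     (simp_all add: poly_calc_add poly_calc_smult scaleC_mult_left distrib_right mult.assoc)

lemma poly_calc_power: "poly_calc u (p ^ n) = poly_calc u p ^ n"
  by (induction n) (simp_all add: poly_calc_mult)

lemma poly_calc_monom_one: "poly_calc u (monom 1 n) = u ^ n"
  by (induction n) (simp_all add: monom_Suc monom_0 scaleC_one)

lemma poly_calc_commute:
  assumes "x * u = u * x"
  shows "x * poly_calc u p = poly_calc u p * x"
proof (induction p)
  case (pCons a p)
  have "x * (u * poly_calc u p) = u * poly_calc u p * x"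
    by (metis assms mult.assoc pCons.IH)
  then show ?case
    by (simp add: distrib_left distrib_right scaleC_mult_left scaleC_mult_right mult.assoc)
qed simp

lemma norm_poly_calc_le:
  assumes "norm u \<le> 1" and "\<And>k. cmod (coeff p k) \<le> B"
  shows "norm (poly_calc u p) \<le> real (degree p + 1) * B"
  using assms(2)
proof (induction p)
  case 0
  then have "0 \<le> B" using norm_ge_zero order_trans by blast
  then show ?case by simp
next
  case (pCons a p)
  have B: "cmod a \<le> B" using pCons.prems[of 0] by simp
  have IH: "norm (poly_calc u p) \<le> real (degree p + 1) * B"
    using pCons.prems[of "Suc k" for k] by (intro pCons.IH) simp
  have "norm (poly_calc u (pCons a p)) \<le> cmod a + norm (u * poly_calc u p)"
    using norm_triangle_ineq[of "scaleC a 1" "u * poly_calc u p"] by (simp add: norm_scaleC)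
  also have "norm (u * poly_calc u p) \<le> norm (poly_calc u p)"
    using norm_mult_ineq[of u "poly_calc u p"] assms(1)
    by (smt (verit) mult_left_le_one_le norm_ge_zero)
  finally have *: "norm (poly_calc u (pCons a p)) \<le> cmod a + norm (poly_calc u p)" by simp
  show ?case
  proof (cases "p = 0")
    case True
    then show ?thesis using * B by simp
  next
    case False
    then show ?thesis using * B IH by (simp add: algebra_simps)
  qed
qed

lemma deriv_funpow_poly: "(deriv ^^ n) (poly p) = poly ((pderiv ^^ n) p)" for p :: "complex poly"
proof (induction n)
  case (Suc n)
  then show ?case by (auto simp: intro!: DERIV_imp_deriv poly_DERIV)
qed simp

text \<open>Cauchy's estimate for the derivatives at 0 on the unit disc; the \<open>k\<close>-th
  derivative there is \<open>fact k\<close> times the coefficient.\<close>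

lemma cmod_coeff_le:
  fixes p :: "complex poly"
  assumes "\<And>z. cmod z = 1 \<Longrightarrow> cmod (poly p z) \<le> B"
  shows "cmod (coeff p k) \<le> B"
proof -
  have "cmod ((deriv ^^ k) (poly p) 0) \<le> fact k * B / 1 ^ k"
    by (rule Cauchy_inequality) (auto intro!: holomorphic_intros continuous_intros assms)
  also have "(deriv ^^ k) (poly p) 0 = fact k * coeff p k"
    by (simp add: deriv_funpow_poly poly_0_coeff_0 coeff_higher_pderiv pochhammer_fact)
  finally show ?thesis by (simp add: norm_mult)
qed

section \<open>Sums for cutting a function into ramps and hats\<close>

lemma sum_ramps: "(\<Sum>j<n. max 0 (min 1 (x - real j))) = max 0 (min (real n) x)"
proof (induction n)
  case (Suc n)
  have "max 0 (min (real n) x) + max 0 (min 1 (x - real n)) = max 0 (min (real (Suc n)) x)"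
    by linarith
  with Suc show ?case by simp
qed simp

lemma sum_lessThan_times_3:
  "(\<Sum>j<3 * M. a j) = (\<Sum>m<M. a (3 * m)) + (\<Sum>m<M. a (3 * m + 1)) + (\<Sum>m<M. a (3 * m + 2))"
  for a :: "nat \<Rightarrow> 'b::comm_monoid_add"
proof (induction M)
  case (Suc M)
  have "{..<3 * Suc M} = insert (3 * M + 2) (insert (3 * M + 1) (insert (3 * M) {..<3 * M}))"
    by auto
  then show ?case using Suc by (simp add: add_ac)
qed simp

section \<open>Continuous functional calculus of a unitary\<close>

locale unitary_element =
  fixes u :: "'a::cstar_algebra"
  assumes adj_mult_self: "adj u * u = 1" and self_mult_adj: "u * adj u = 1"
begin

lemma norm_unitary: "norm u = 1"
proof -
  have "norm u * norm u = 1"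
    using cstar_identity[of u] by (simp add: adj_mult_self)
  then show ?thesis
    by (metis abs_norm_cancel abs_square_eq_1 power2_eq_square)
qed

text \<open>\<open>poly_calc_commute\<close> is used twice: \<open>adj u\<close> commutes with
  \<open>u\<close>, hence with the polynomial; taking adjoints, \<open>adj (poly_calc u p)\<close>
  commutes with \<open>u\<close>, hence again with the polynomial.\<close>

lemma poly_calc_normal: "adj (poly_calc u p) * poly_calc u p = poly_calc u p * adj (poly_calc u p)"
proof -
  have "adj u * poly_calc u p = poly_calc u p * adj u"
    by (rule poly_calc_commute) (simp add: adj_mult_self self_mult_adj)
  then have "adj (poly_calc u p) * u = u * adj (poly_calc u p)"
    by (metis adj_adj adj_mult)
  then show ?thesis by (rule poly_calc_commute)
qed

text \<open>The crude coefficient estimate loses a factor that is linear in the degree. It disappears in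
  the limit \<open>m \<rightarrow> \<infinity>\<close> when applied to the powers \<open>p ^ m\<close>.\<close>

lemma norm_poly_calc_le_sup:
  assumes "\<And>z. cmod z = 1 \<Longrightarrow> cmod (poly p z) \<le> B"
  shows "norm (poly_calc u p) \<le> B"
proof (rule ccontr)
  assume "\<not> ?thesis"
  then have less: "B < norm (poly_calc u p)" by simp
  have "0 \<le> B" using assms[of 1] norm_ge_zero order_trans by (metis norm_one)
  define q where "q = B / norm (poly_calc u p)"
  have q: "0 \<le> q" "q < 1" using less \<open>0 \<le> B\<close> by (auto simp: q_def divide_less_eq)
  define d where "d = real (degree p)"
  \<comment> \<open>Only powers of two are available from \<open>norm_power_normal\<close>; they are
    unbounded, which is enough to contradict the limit 0.\<close>
  have "1 \<le> (d * m + 1) * q ^ m" if m: "m = 2 ^ n" for m n :: nat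
  proof -
    have "norm (poly_calc u p) ^ m = norm (poly_calc u (p ^ m))"
      by (simp add: m poly_calc_power norm_power_normal poly_calc_normal)
    also have "\<dots> \<le> real (degree (p ^ m) + 1) * B ^ m"
    proof (rule norm_poly_calc_le)
      show "cmod (coeff (p ^ m) k) \<le> B ^ m" for k
        by (rule cmod_coeff_le) (auto simp: norm_power intro!: power_mono assms)
    qed (simp add: norm_unitary)
    also have "\<dots> \<le> (d * m + 1) * B ^ m"
      using degree_power_le[of p m] \<open>0 \<le> B\<close>
      by (intro mult_right_mono) (auto simp: d_def simp flip: of_nat_mult)
    finally show ?thesis
      using less \<open>0 \<le> B\<close> by (simp add: q_def power_divide le_divide_eq)
        (metis le_less_trans zero_less_power)
  qed
  moreover have "(\<lambda>m. (d * real m + 1) * q ^ m) \<longlonglongrightarrow> 0"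
  proof -
    have "(\<lambda>m. d * (real m * q ^ m) + q ^ m) \<longlonglongrightarrow> d * 0 + 0"
      using q by (intro tendsto_intros powser_times_n_limit_0 LIMSEQ_power_zero) auto
    then show ?thesis by (simp add: algebra_simps)
  qed
  then obtain M where M: "\<And>m. m \<ge> M \<Longrightarrow> (d * real m + 1) * q ^ m < 1"
    using order_tendstoD(2)[of _ 0 sequentially 1] unfolding eventually_sequentially by fastforce
  moreover have "M \<le> 2 ^ M" by simp
  ultimately show False by (metis not_le)
qed

text \<open>Laurent polynomials on the circle, where \<open>cnj z\<close> is the inverse of
  \<open>z\<close>. A relation is used because a function has many representations
  \<open>(n, p)\<close>; that they all give the same element comes out of the norm bound.\<close>

definition laurent_calc :: "(complex \<Rightarrow> complex) \<Rightarrow> 'a \<Rightarrow> bool" where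
  "laurent_calc f y \<longleftrightarrow> (\<exists>n p. (\<forall>z. cmod z = 1 \<longrightarrow> f z = cnj z ^ n * poly p z) \<and>
     y = adj u ^ n * poly_calc u p)"

lemma laurent_calc_bound:
  assumes "laurent_calc f y" and f: "\<And>z. cmod z = 1 \<Longrightarrow> cmod (f z) \<le> B"
  shows "norm y \<le> B"
proof -
  obtain n p where fz: "\<And>z. cmod z = 1 \<Longrightarrow> f z = cnj z ^ n * poly p z"
    and y: "y = adj u ^ n * poly_calc u p"
    using assms unfolding laurent_calc_def by blast
  have "norm y \<le> norm (adj u ^ n) * norm (poly_calc u p)"
    unfolding y by (rule norm_mult_ineq)
  also have "\<dots> \<le> 1 * norm (poly_calc u p)"
    using norm_power_ineq[of "adj u" n] by (intro mult_right_mono) (auto simp: norm_unitary)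
  also have "1 * norm (poly_calc u p) \<le> B"
    using f fz by (simp, intro norm_poly_calc_le_sup) (simp add: norm_mult norm_power)
  finally show ?thesis .
qed

lemma adj_power_mult_power: "adj u ^ n * u ^ n = 1"
proof (induction n)
  case (Suc n)
  have "adj u ^ Suc n * u ^ Suc n = adj u * (adj u ^ n * u ^ n) * u"
    by (simp add: mult.assoc power_commutes)
  then show ?case by (simp add: Suc adj_mult_self)
qed simp

lemma cnj_power_mult_power: "cmod z = 1 \<Longrightarrow> cnj z ^ n * z ^ n = 1"
  by (metis complex_cnj_mult complex_norm_square mult.commute of_real_1 one_power2 power_mult_distrib power_one)

text \<open>Brings two representations to a common power of \<open>cnj z\<close>, so that they can
  be added.\<close>

lemma laurent_calc_raise:
  assumes "cmod z = 1"
  shows "cnj z ^ (n + m) * poly (monom 1 m * p) z = cnj z ^ n * poly p z"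
    and "adj u ^ (n + m) * poly_calc u (monom 1 m * p) = adj u ^ n * poly_calc u p"
proof -
  show "cnj z ^ (n + m) * poly (monom 1 m * p) z = cnj z ^ n * poly p z"
    using cnj_power_mult_power[OF assms, of m]
    by (simp add: power_add poly_monom mult_ac)
  show "adj u ^ (n + m) * poly_calc u (monom 1 m * p) = adj u ^ n * poly_calc u p"
    by (simp add: power_add poly_calc_mult poly_calc_monom_one mult.assoc)
       (metis adj_power_mult_power mult.assoc mult_1_left)
qed

lemma laurent_calc_add:
  assumes "laurent_calc f x" "laurent_calc g y"
  shows "laurent_calc (\<lambda>z. f z + g z) (x + y)"
proof -
  obtain n p m q where f: "\<And>z. cmod z = 1 \<Longrightarrow> f z = cnj z ^ n * poly p z"
    and x: "x = adj u ^ n * poly_calc u p"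
    and g: "\<And>z. cmod z = 1 \<Longrightarrow> g z = cnj z ^ m * poly q z"
    and y: "y = adj u ^ m * poly_calc u q"
    using assms unfolding laurent_calc_def by metis
  let ?r = "monom 1 m * p + monom 1 n * q"
  have "f z + g z = cnj z ^ (n + m) * poly ?r z" if "cmod z = 1" for z
    using laurent_calc_raise(1)[OF that, of n m p] laurent_calc_raise(1)[OF that, of m n q]
    by (simp add: f g that distrib_left add.commute del: poly_mult)
  moreover have "x + y = adj u ^ (n + m) * poly_calc u ?r"
    using laurent_calc_raise(2)[of 1 n m p] laurent_calc_raise(2)[of 1 m n q]
    by (simp add: x y poly_calc_add distrib_left add.commute)
  ultimately show ?thesis unfolding laurent_calc_def by blast
qed

lemma laurent_calc_mult:
  assumes "laurent_calc f x" "laurent_calc g y"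
  shows "laurent_calc (\<lambda>z. f z * g z) (x * y)"
proof -
  obtain n p m q where f: "\<And>z. cmod z = 1 \<Longrightarrow> f z = cnj z ^ n * poly p z"
    and x: "x = adj u ^ n * poly_calc u p"
    and g: "\<And>z. cmod z = 1 \<Longrightarrow> g z = cnj z ^ m * poly q z"
    and y: "y = adj u ^ m * poly_calc u q"
    using assms unfolding laurent_calc_def by metis
  have "adj u ^ m * u = u * adj u ^ m"
    by (rule power_commuting_commutes) (simp add: adj_mult_self self_mult_adj)
  then have "adj u ^ m * poly_calc u p = poly_calc u p * adj u ^ m"
    by (rule poly_calc_commute)
  then have "x * y = adj u ^ (n + m) * poly_calc u (p * q)"
    by (simp add: x y power_add poly_calc_mult mult.assoc) (metis mult.assoc)
  moreover have "f z * g z = cnj z ^ (n + m) * poly (p * q) z" if "cmod z = 1" for z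
    by (simp add: f g that power_add)
  ultimately show ?thesis unfolding laurent_calc_def by blast
qed

lemma laurent_calc_const: "laurent_calc (\<lambda>z. c) (scaleC c 1)"
  unfolding laurent_calc_def by (intro exI[of _ 0] exI[of _ "[:c:]"]) simp

lemma laurent_calc_id: "laurent_calc (\<lambda>z. z) u"
  unfolding laurent_calc_def by (intro exI[of _ 0] exI[of _ "[:0, 1:]"]) (simp add: scaleC_one)

lemma laurent_calc_cnj: "laurent_calc cnj (adj u)"
  unfolding laurent_calc_def by (intro exI[of _ 1] exI[of _ 1]) simp

lemma laurent_calc_diff:
  assumes "laurent_calc f x" "laurent_calc g y"
  shows "laurent_calc (\<lambda>z. f z - g z) (x - y)"
proof -
  show ?thesis
    using laurent_calc_add[OF assms(1) laurent_calc_mult[OF laurent_calc_const[of "-1"] assms(2)]]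
    by (simp add: scaleC_minus_left scaleC_one)
qed

lemma laurent_calc_real_polynomial:
  assumes "real_polynomial_function p"
  shows "\<exists>y. laurent_calc (\<lambda>z. of_real (p z)) y"
  using assms
proof (induction p rule: real_polynomial_function.induct)
  case (linear f)
  interpret f: bounded_linear f by fact
  \<comment> \<open>Obtained by substituting Re z = (z + cnj z) / 2 and Im z = (z - cnj z) / (2i)
    into Re z * f 1 + Im z * f i.\<close>
  define b where "b = (f 1 - \<i> * f \<i>) / 2"
  have "of_real (f z) = b * z + cnj b * cnj z" for z
  proof -
    have "f z = f (Re z *\<^sub>R 1 + Im z *\<^sub>R \<i>)"
      by (rule arg_cong[where f = f]) (simp add: complex_eq_iff)
    also have "\<dots> = Re z * f 1 + Im z * f \<i>"
      by (simp add: f.add f.scaleR)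
    finally show ?thesis by (simp add: b_def complex_eq_iff field_simps)
  qed
  then show ?case
    using laurent_calc_add[OF laurent_calc_mult[OF laurent_calc_const[of b] laurent_calc_id]
        laurent_calc_mult[OF laurent_calc_const[of "cnj b"] laurent_calc_cnj]] by auto
next
  case (const c)
  then show ?case using laurent_calc_const by blast
next
  case (add f g)
  then show ?case using laurent_calc_add by fastforce
next
  case (mult f g)
  then show ?case using laurent_calc_mult by fastforce
qed

lemma laurent_calc_dense:
  assumes "continuous_on (sphere 0 1) f" and "e > 0"
  shows "\<exists>g y. laurent_calc g y \<and> (\<forall>z. cmod z = 1 \<longrightarrow> cmod (f z - g z) < e)"
proof -
  obtain g where g: "polynomial_function g" and close: "\<forall>z\<in>sphere 0 1. norm (f z - g z) < e"
    using Stone_Weierstrass_polynomial_function[OF compact_sphere assms] by blast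
  have "real_polynomial_function (Re \<circ> g)" "real_polynomial_function (Im \<circ> g)"
    using g bounded_linear_Re bounded_linear_Im unfolding polynomial_function_def by blast+
  then obtain x y where "laurent_calc (\<lambda>z. of_real ((Re \<circ> g) z)) x"
      "laurent_calc (\<lambda>z. of_real ((Im \<circ> g) z)) y"
    using laurent_calc_real_polynomial by blast
  then have "laurent_calc (\<lambda>z. of_real ((Re \<circ> g) z) + \<i> * of_real ((Im \<circ> g) z)) (x + scaleC \<i> 1 * y)"
    by (intro laurent_calc_add laurent_calc_mult laurent_calc_const)
  moreover have "of_real ((Re \<circ> g) z) + \<i> * of_real ((Im \<circ> g) z) = g z" for z
    by (simp add: complex_eq_iff)
  ultimately show ?thesis using close by (auto simp: dist_norm)
qed

text \<open>Still a relation: sums, products and bounds pass to the limit directly, before the limit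
  is known to be independent of the approximating sequence.\<close>

definition calc_rel :: "(complex \<Rightarrow> complex) \<Rightarrow> 'a \<Rightarrow> bool" where
  "calc_rel f y \<longleftrightarrow> (\<exists>F Y. (\<forall>n. laurent_calc (F n) (Y n)) \<and>
     uniform_limit (sphere 0 1) F f sequentially \<and> Y \<longlonglongrightarrow> y)"

lemma calc_rel_laurent:
  assumes "laurent_calc f y" shows "calc_rel f y"
  unfolding calc_rel_def using assms
  by (intro exI[of _ "\<lambda>_. f"] exI[of _ "\<lambda>_. y"]) (auto intro: uniform_limit_const)

lemma calc_rel_add:
  assumes "calc_rel f x" "calc_rel g y"
  shows "calc_rel (\<lambda>z. f z + g z) (x + y)"
proof -
  obtain F X G Y where "\<And>n. laurent_calc (F n) (X n)" "uniform_limit (sphere 0 1) F f sequentially"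
    "X \<longlonglongrightarrow> x" "\<And>n. laurent_calc (G n) (Y n)" "uniform_limit (sphere 0 1) G g sequentially"
    "Y \<longlonglongrightarrow> y"
    using assms unfolding calc_rel_def by metis
  then show ?thesis
    unfolding calc_rel_def
    by (intro exI[of _ "\<lambda>n z. F n z + G n z"] exI[of _ "\<lambda>n. X n + Y n"])
       (auto intro!: laurent_calc_add uniform_limit_add tendsto_add)
qed

lemma bounded_continuous_image_sphere:
  "continuous_on (sphere 0 1) f \<Longrightarrow> bounded (f ` sphere 0 1)" for f :: "complex \<Rightarrow> complex"
  by (intro compact_imp_bounded compact_continuous_image) auto

text \<open>Continuity makes the limits bounded on the compact circle, which lets the uniform limits
  be multiplied.\<close>

lemma calc_rel_mult:
  assumes "calc_rel f x" "calc_rel g y"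
    and "continuous_on (sphere 0 1) f" "continuous_on (sphere 0 1) g"
  shows "calc_rel (\<lambda>z. f z * g z) (x * y)"
proof -
  obtain F X G Y where "\<And>n. laurent_calc (F n) (X n)" "uniform_limit (sphere 0 1) F f sequentially"
    "X \<longlonglongrightarrow> x" "\<And>n. laurent_calc (G n) (Y n)" "uniform_limit (sphere 0 1) G g sequentially"
    "Y \<longlonglongrightarrow> y"
    using assms unfolding calc_rel_def by metis
  with assms(3,4) show ?thesis
    unfolding calc_rel_def
    by (intro exI[of _ "\<lambda>n z. F n z * G n z"] exI[of _ "\<lambda>n. X n * Y n"])
       (auto intro!: laurent_calc_mult uniform_lim_mult tendsto_mult bounded_continuous_image_sphere)
qed

lemma calc_rel_bound:
  assumes "calc_rel f y" and f: "\<And>z. cmod z = 1 \<Longrightarrow> cmod (f z) \<le> B"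
  shows "norm y \<le> B"
proof (rule field_le_epsilon)
  fix e :: real assume "e > 0"
  obtain F Y where F: "\<And>n. laurent_calc (F n) (Y n)" and lim: "uniform_limit (sphere 0 1) F f sequentially"
    and Y: "Y \<longlonglongrightarrow> y"
    using assms unfolding calc_rel_def by metis
  have "eventually (\<lambda>n. norm (Y n) \<le> B + e) sequentially"
    using uniform_limitD[OF lim \<open>e > 0\<close>]
  proof eventually_elim
    case (elim n)
    show ?case
    proof (rule laurent_calc_bound[OF F])
      fix z :: complex assume z: "cmod z = 1"
      have "cmod (F n z) \<le> cmod (f z) + dist (F n z) (f z)"
        by (metis add.commute dist_norm norm_triangle_sub)
      then show "cmod (F n z) \<le> B + e" using elim z f[OF z] by force
    qed
  qed
  then show "norm y \<le> B + e"
    using tendsto_norm[OF Y] by (intro tendsto_upperbound) auto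
qed

text \<open>The norm bound applied to differences of uniform approximants makes their values a
  Cauchy sequence.\<close>

lemma calc_rel_exists:
  assumes "continuous_on (sphere 0 1) f"
  shows "\<exists>y. calc_rel f y"
proof -
  have "\<forall>n. \<exists>g y. laurent_calc g y \<and> (\<forall>z. cmod z = 1 \<longrightarrow> cmod (f z - g z) < inverse (real (Suc n)))"
    using laurent_calc_dense[OF assms] by simp
  then obtain F Y where F: "\<And>n. laurent_calc (F n) (Y n)"
    and close: "\<And>n z. cmod z = 1 \<Longrightarrow> cmod (f z - F n z) < inverse (real (Suc n))"
    by metis
  have "uniform_limit (sphere 0 1) F f sequentially"
  proof (rule uniform_limitI)
    fix e :: real assume "e > 0"
    with LIMSEQ_inverse_real_of_nat have "\<forall>\<^sub>F n in sequentially. inverse (Suc n) < e"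
      by (rule order_tendstoD)
    then show "\<forall>\<^sub>F n in sequentially. \<forall>z\<in>sphere 0 1. dist (F n z) (f z) < e"
    proof eventually_elim
      case (elim n)
      then show ?case
        using close[of _ n] by (metis dist_commute dist_norm less_trans mem_sphere_0)
    qed
  qed
  moreover have "Cauchy Y"
  proof (rule CauchyI)
    fix e :: real assume "e > 0"
    then obtain N where N: "inverse (real (Suc N)) < e / 2"
      using reals_Archimedean[of "e / 2"] by auto
    have "norm (Y m - Y n) < e" if "m \<ge> N" "n \<ge> N" for m n
    proof -
      have "norm (Y m - Y n) \<le> inverse (real (Suc N)) + inverse (real (Suc N))"
      proof (rule laurent_calc_bound[OF laurent_calc_diff[OF F F]])
        fix z :: complex assume z: "cmod z = 1"
        have "cmod (F m z - F n z) \<le> cmod (f z - F m z) + cmod (f z - F n z)"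
          using norm_triangle_ineq4[of "f z - F n z" "f z - F m z"] by (simp add: algebra_simps)
        moreover have "inverse (real (Suc m)) \<le> inverse (real (Suc N))"
          "inverse (real (Suc n)) \<le> inverse (real (Suc N))" using that by (auto intro!: le_imp_inverse_le)
        ultimately show "cmod (F m z - F n z) \<le> inverse (real (Suc N)) + inverse (real (Suc N))"
          using close[OF z, of m] close[OF z, of n] by linarith
      qed
      with N show ?thesis by simp
    qed
    then show "\<exists>M. \<forall>m\<ge>M. \<forall>n\<ge>M. norm (Y m - Y n) < e" by blast
  qed
  then obtain y where "Y \<longlonglongrightarrow> y" using Cauchy_convergent convergent_def by blast
  ultimately show ?thesis using F unfolding calc_rel_def by blast
qed

definition calc :: "(complex \<Rightarrow> complex) \<Rightarrow> 'a" where
  "calc f = (SOME y. calc_rel f y)"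

lemma calc_rel_calc: "continuous_on (sphere 0 1) f \<Longrightarrow> calc_rel f (calc f)"
  unfolding calc_def using calc_rel_exists by (rule someI_ex)

text \<open>The difference \<open>y - calc g\<close> is related to a function that vanishes on the
  circle, so \<open>calc_rel_bound\<close> with bound 0 kills it. This is the uniqueness behind the
  choice in \<open>calc\<close>.\<close>

lemma calc_eqI:
  assumes "calc_rel f y" "\<And>z. cmod z = 1 \<Longrightarrow> f z = g z" "continuous_on (sphere 0 1) g"
  shows "calc g = y"
proof -
  have "calc_rel (\<lambda>z. f z + -1 * g z) (y + scaleC (-1) 1 * calc g)"
    by (intro calc_rel_add assms(1) calc_rel_mult calc_rel_calc calc_rel_laurent laurent_calc_const
        assms(3) continuous_intros)
  then have "norm (y + scaleC (-1) 1 * calc g) \<le> 0"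
    by (rule calc_rel_bound) (simp add: assms(2))
  then show ?thesis by (simp add: scaleC_minus_left scaleC_one)
qed

lemma calc_add:
  assumes "continuous_on (sphere 0 1) f" "continuous_on (sphere 0 1) g"
  shows "calc (\<lambda>z. f z + g z) = calc f + calc g"
  by (rule calc_eqI[OF calc_rel_add]) (auto intro: calc_rel_calc continuous_intros assms)

lemma calc_mult:
  assumes "continuous_on (sphere 0 1) f" "continuous_on (sphere 0 1) g"
  shows "calc (\<lambda>z. f z * g z) = calc f * calc g"
  by (rule calc_eqI[OF calc_rel_mult]) (auto intro: calc_rel_calc continuous_intros assms)

lemma calc_const: "calc (\<lambda>z. c) = scaleC c 1"
  by (rule calc_eqI[OF calc_rel_laurent[OF laurent_calc_const]]) auto

lemma calc_id: "calc (\<lambda>z. z) = u"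
  by (rule calc_eqI[OF calc_rel_laurent[OF laurent_calc_id]]) auto

lemma norm_calc_le:
  assumes "continuous_on (sphere 0 1) f" "\<And>z. cmod z = 1 \<Longrightarrow> cmod (f z) \<le> B"
  shows "norm (calc f) \<le> B"
  using calc_rel_bound[OF calc_rel_calc] assms by blast

section \<open>Real-valued functions and zero products\<close>

definition real_calc :: "(complex \<Rightarrow> real) \<Rightarrow> 'a" where
  "real_calc f = calc (\<lambda>z. of_real (f z))"

lemma real_calc_cong:
  assumes "continuous_on (sphere 0 1) f" "continuous_on (sphere 0 1) g"
    "\<And>z. cmod z = 1 \<Longrightarrow> f z = g z"
  shows "real_calc f = real_calc g"
  unfolding real_calc_def
  by (rule calc_eqI[OF calc_rel_calc]) (auto intro!: continuous_intros assms simp: assms(3))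

lemma real_calc_add:
  assumes "continuous_on (sphere 0 1) f" "continuous_on (sphere 0 1) g"
  shows "real_calc (\<lambda>z. f z + g z) = real_calc f + real_calc g"
  unfolding real_calc_def of_real_add by (rule calc_add) (intro continuous_intros assms)+

lemma real_calc_mult:
  assumes "continuous_on (sphere 0 1) f" "continuous_on (sphere 0 1) g"
  shows "real_calc (\<lambda>z. f z * g z) = real_calc f * real_calc g"
  unfolding real_calc_def of_real_mult by (rule calc_mult) (intro continuous_intros assms)+

lemma real_calc_const: "real_calc (\<lambda>z. c) = c *\<^sub>R 1"
  by (simp add: real_calc_def calc_const scaleR_scaleC)

lemma real_calc_scaleR:
  assumes "continuous_on (sphere 0 1) f"
  shows "real_calc (\<lambda>z. c * f z) = c *\<^sub>R real_calc f"
  by (simp add: real_calc_mult assms real_calc_const)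

lemma real_calc_diff:
  assumes "continuous_on (sphere 0 1) f" "continuous_on (sphere 0 1) g"
  shows "real_calc (\<lambda>z. f z - g z) = real_calc f - real_calc g"
  using real_calc_add[of f "\<lambda>z. -1 * g z"] assms
  by (simp add: real_calc_scaleR[of _ "-1", simplified] continuous_on_minus)

lemma real_calc_sum:
  assumes "\<And>i. continuous_on (sphere 0 1) (f i)"
  shows "real_calc (\<lambda>z. \<Sum>i\<in>A. f i z) = (\<Sum>i\<in>A. real_calc (f i))"
  by (induction A rule: infinite_finite_induct)
     (simp_all add: real_calc_const[of 0, simplified] real_calc_add assms continuous_on_sum)

lemma norm_real_calc_le:
  assumes "continuous_on (sphere 0 1) f" "\<And>z. cmod z = 1 \<Longrightarrow> \<bar>f z\<bar> \<le> B"
  shows "norm (real_calc f) \<le> B"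
  unfolding real_calc_def using assms by (intro norm_calc_le) (auto intro!: continuous_intros)

text \<open>The key estimate, uniform in \<open>M\<close>: writing \<open>k\<close> as a sum of the ramps \<open>R (j + 1)\<close>, the
  commutator-like expression collapses to the terms \<open>V (H i) (H j)\<close> for neighbouring hat functions
  \<open>H\<close>. Hats whose indices agree modulo 3 have disjoint supports, so all these terms are
  collected in six values of \<open>V\<close> at sums of hats, and such sums are bounded by 1.\<close>

lemma real_calc_zero_product_bound:
  assumes V: "bounded_bilinear V"
    and zero: "\<And>x y. x * y = 0 \<Longrightarrow> V x y = 0"
    and K: "\<And>x y. norm (V x y) \<le> norm x * norm y * K"
    and contk: "continuous_on (sphere 0 1) k"
    and k: "\<And>z. cmod z = 1 \<Longrightarrow> 0 \<le> k z \<and> k z \<le> real (3 * M)"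
  shows "norm (V (real_calc k) 1 - V 1 (real_calc k)) \<le> 6 * K"
proof -
  interpret V: bounded_bilinear V by fact
  \<comment> \<open>\<open>R j\<close> rises from 0 to 1 as \<open>k\<close> runs from j - 1 to j.
    The shift makes \<open>R 0\<close> equal to 1 on the circle, and the ramps that add up to
    \<open>k\<close> start at index 1.\<close>
  define R where "R j z = max 0 (min 1 (k z + 1 - real j))" for j z
  \<comment> \<open>A hat in the value of \<open>k\<close>, with peak at j and support between j - 1
    and j + 1.\<close>
  define H where "H j z = R j z - R (Suc j) z" for j z
  define r where "r j = real_calc (R j)" for j
  define h where "h j = real_calc (H j)" for j
  have contR [continuous_intros]: "continuous_on (sphere 0 1) (R j)" for j
    unfolding R_def[abs_def] by (intro continuous_intros contk)
  have contH [continuous_intros]: "continuous_on (sphere 0 1) (H j)" for j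
    unfolding H_def[abs_def] by (intro continuous_intros)
  have h: "h j = r j - r (Suc j)" for j
    unfolding h_def r_def H_def[abs_def] by (intro real_calc_diff continuous_intros)
  have disj: "V (real_calc f) (real_calc g) = 0"
    if "continuous_on (sphere 0 1) f" "continuous_on (sphere 0 1) g"
      "\<And>z. f z * g z = 0" for f g
    by (intro zero) (simp add: that real_calc_const flip: real_calc_mult)
  have one: "1 - r i = real_calc (\<lambda>z. 1 - R i z)" for i
    unfolding r_def by (simp add: real_calc_diff contR real_calc_const)
  \<comment> \<open>A later ramp starts only after every earlier one has reached 1. Hence
    \<open>R j\<close> and \<open>1 - R i\<close> have product 0, and next to \<open>r j\<close> the
    element \<open>r i\<close> acts in \<open>V\<close> like 1.\<close>
  have ramp: "R j z = 0 \<or> R i z = 1" if "i < j" for i j z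
    using that by (cases "k z + 1 \<le> real j") (auto simp: R_def)
  have right: "V (r j) (r i) = V (r j) 1" if "i < j" for i j
  proof -
    have "V (r j) (1 - r i) = 0"
      unfolding one unfolding r_def
      by (intro disj continuous_intros) (use ramp[OF that] in auto)
    then show ?thesis by (simp add: V.diff_right)
  qed
  have left: "V (r i) (r j) = V 1 (r j)" if "i < j" for i j
  proof -
    have "V (1 - r i) (r j) = 0"
      unfolding one unfolding r_def
      by (intro disj continuous_intros) (use ramp[OF that] in auto)
    then show ?thesis by (simp add: V.diff_left)
  qed
  \<comment> \<open>After expansion by \<open>left\<close> and \<open>right\<close>, the terms with
    \<open>r (Suc (Suc j))\<close> cancel within each value of \<open>V\<close>, and
    \<open>V (r (Suc j)) (r (Suc j))\<close> cancels between the two.\<close>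
  have step: "V (r (Suc j)) 1 - V 1 (r (Suc j)) = V (h (Suc j)) (h j) - V (h j) (h (Suc j))" for j
    by (simp add: h V.diff_left V.diff_right left right)
  have rk: "real_calc k = (\<Sum>j<3 * M. r (Suc j))"
  proof -
    have "real_calc k = real_calc (\<lambda>z. \<Sum>j<3 * M. R (Suc j) z)"
    proof (rule real_calc_cong)
      show "k z = (\<Sum>j<3 * M. R (Suc j) z)" if "cmod z = 1" for z
        using sum_ramps[of "k z" "3 * M"] k[OF that] by (simp add: R_def)
    qed (intro continuous_intros contk)+
    then show ?thesis by (simp add: real_calc_sum contR r_def)
  qed
  have nonneg: "0 \<le> H j z" for j z
    by (simp add: H_def R_def)
  \<comment> \<open>The sum over all hats would telescope. Taking every third one leaves gaps, which
    only lower the value since \<open>R\<close> decreases in its index.\<close>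
  have sum_H: "(\<Sum>m<n. H (3 * m + s) z) \<le> R s z - R (3 * n + s) z" for n s z
  proof (induction n)
    case (Suc n)
    have "R (3 * Suc n + s) z \<le> R (Suc (3 * n + s)) z" by (auto simp: R_def)
    then show ?case using Suc by (simp add: H_def)
  qed simp
  have sum_h: "norm (\<Sum>m<M. h (3 * m + s)) \<le> 1" for s
  proof -
    have "R s z - R (3 * M + s) z \<le> 1" for z by (auto simp: R_def)
    then have "\<bar>\<Sum>m<M. H (3 * m + s) z\<bar> \<le> 1" for z
      using sum_H[of s z M] sum_nonneg[of "{..<M}" "\<lambda>m. H (3 * m + s) z"] nonneg
      by (smt (verit))
    then have "norm (real_calc (\<lambda>z. \<Sum>m<M. H (3 * m + s) z)) \<le> 1"
      by (intro norm_real_calc_le continuous_intros) auto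
    then show ?thesis by (simp add: real_calc_sum contH h_def)
  qed
  have far: "V (h i) (h j) = 0" if "i + 2 \<le> j \<or> j + 2 \<le> i" for i j
  proof -
    have "H i z * H j z = 0" for z
    proof -
      have "H i z = 0 \<or> H j z = 0" if "i + 2 \<le> j" for i j
        using ramp[of "Suc i" j z] ramp[of i "Suc i" z] ramp[of j "Suc j" z] that
        by (cases "k z + 1 \<le> real j") (auto simp: H_def R_def)
      with that show ?thesis by auto
    qed
    then show ?thesis
      unfolding h_def by (intro disj continuous_intros)
  qed
  have collect: "norm (\<Sum>m<M. V (h (3 * m + s)) (h (3 * m + t))) \<le> K"
    if st: "s \<le> t + 1" "t \<le> s + 1" for s t
  proof -
    have "V (\<Sum>m<M. h (3 * m + s)) (\<Sum>m<M. h (3 * m + t))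
        = (\<Sum>m<M. \<Sum>n<M. V (h (3 * m + s)) (h (3 * n + t)))"
      by (simp only: V.sum_left V.sum_right) (rule sum.swap)
    also have "\<dots> = (\<Sum>m<M. \<Sum>n<M. if n = m then V (h (3 * m + s)) (h (3 * m + t)) else 0)"
    proof (intro sum.cong refl)
      fix m n
      \<comment> \<open>As \<open>s\<close> and \<open>t\<close> differ by at most 1, the two
        indices differ by at least 2 when \<open>m\<close> and \<open>n\<close> are distinct, so
        only the diagonal survives.\<close>
      have "V (h (3 * m + s)) (h (3 * n + t)) = 0" if "m \<noteq> n"
        using that st by (intro far) (cases "m < n"; simp)
      then show "V (h (3 * m + s)) (h (3 * n + t))
          = (if n = m then V (h (3 * m + s)) (h (3 * m + t)) else 0)" by auto
    qed
    also have "\<dots> = (\<Sum>m<M. V (h (3 * m + s)) (h (3 * m + t)))"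
      by simp
    finally have eq: "V (\<Sum>m<M. h (3 * m + s)) (\<Sum>m<M. h (3 * m + t))
        = (\<Sum>m<M. V (h (3 * m + s)) (h (3 * m + t)))" .
    have "norm (\<Sum>m<M. V (h (3 * m + s)) (h (3 * m + t)))
        \<le> norm (\<Sum>m<M. h (3 * m + s)) * norm (\<Sum>m<M. h (3 * m + t)) * K"
      unfolding eq[symmetric] by (rule K)
    also have "\<dots> \<le> 1 * K"
    proof (rule mult_right_mono)
      show "norm (\<Sum>m<M. h (3 * m + s)) * norm (\<Sum>m<M. h (3 * m + t)) \<le> 1"
        using sum_h by (intro mult_le_one) auto
      have "0 \<le> norm (1::'a) * norm (1::'a) * K" using K[of 1 1] norm_ge_zero order_trans by blast
      then show "0 \<le> K" by simp
    qed
    finally show ?thesis by simp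
  qed
  have "norm (\<Sum>j<3 * M. V (h (Suc j)) (h j)) \<le> K + K + K"
    unfolding sum_lessThan_times_3[of _ M]
    using collect[of 1 0] collect[of 2 1] collect[of 3 2]
    by (intro norm_triangle_mono) (simp_all add: numeral_2_eq_2 numeral_3_eq_3)
  moreover have "norm (\<Sum>j<3 * M. V (h j) (h (Suc j))) \<le> K + K + K"
    unfolding sum_lessThan_times_3[of _ M]
    using collect[of 0 1] collect[of 1 2] collect[of 2 3]
    by (intro norm_triangle_mono) (simp_all add: numeral_2_eq_2 numeral_3_eq_3)
  moreover have "V (real_calc k) 1 - V 1 (real_calc k)
      = (\<Sum>j<3 * M. V (h (Suc j)) (h j)) - (\<Sum>j<3 * M. V (h j) (h (Suc j)))"
    by (simp add: rk V.sum_left V.sum_right step flip: sum_subtractf)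
  ultimately show ?thesis
    using norm_triangle_ineq4[of "\<Sum>j<3 * M. V (h (Suc j)) (h j)" "\<Sum>j<3 * M. V (h j) (h (Suc j))"]
    by simp
qed

text \<open>Replacing \<open>k\<close> by 3M times \<open>k\<close> multiplies the difference by 3M,
  while the bound \<open>6 * K\<close> does not depend on M. So the difference is 0.\<close>

lemma real_calc_zero_product_balanced:
  assumes V: "bounded_bilinear V"
    and zero: "\<And>x y. x * y = 0 \<Longrightarrow> V x y = 0"
    and contk: "continuous_on (sphere 0 1) k"
    and k: "\<And>z. cmod z = 1 \<Longrightarrow> 0 \<le> k z \<and> k z \<le> 1"
  shows "V (real_calc k) 1 = V 1 (real_calc k)"
proof (rule ccontr)
  interpret V: bounded_bilinear V by fact
  let ?d = "V (real_calc k) 1 - V 1 (real_calc k)"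
  assume "V (real_calc k) 1 \<noteq> V 1 (real_calc k)"
  then have pos: "norm ?d > 0" by simp
  obtain K where K: "\<And>x y. norm (V x y) \<le> norm x * norm y * K"
    using V.bounded by blast
  obtain M where M: "6 * K < real M * norm ?d"
    using reals_Archimedean3[OF pos] by blast
  have "norm (V (real_calc (\<lambda>z. real (3 * M) * k z)) 1 - V 1 (real_calc (\<lambda>z. real (3 * M) * k z)))
      \<le> 6 * K"
  proof (rule real_calc_zero_product_bound[OF V zero K])
    show "0 \<le> real (3 * M) * k z \<and> real (3 * M) * k z \<le> real (3 * M)" if "cmod z = 1" for z
      using k[OF that] by (simp add: mult_left_le)
  qed (auto intro!: continuous_intros contk)
  also have "V (real_calc (\<lambda>z. real (3 * M) * k z)) 1 - V 1 (real_calc (\<lambda>z. real (3 * M) * k z))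
      = real (3 * M) *\<^sub>R ?d"
    unfolding real_calc_scaleR[OF contk]
    by (simp add: V.scaleR_left V.scaleR_right scaleR_diff_right)
  finally have "real (3 * M) * norm ?d \<le> 6 * K" by simp
  moreover have "real M * norm ?d \<le> real (3 * M) * norm ?d"
    by (intro mult_right_mono) auto
  ultimately show False using M by linarith
qed

lemma zero_product_balanced_unitary:
  fixes V :: "'a \<Rightarrow> 'a \<Rightarrow> 'b::cstar_algebra"
  assumes V: "bounded_bilinear V"
    and zero: "\<And>x y. x * y = 0 \<Longrightarrow> V x y = 0"
    and left: "\<And>c x y. V (scaleC c x) y = scaleC c (V x y)"
    and right: "\<And>c x y. V x (scaleC c y) = scaleC c (V x y)"
  shows "V u 1 = V 1 u"
proof -
  interpret V: bounded_bilinear V by fact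
  have part: "V (real_calc k) 1 = V 1 (real_calc k)"
    if contk: "continuous_on (sphere 0 1) k" and k: "\<And>z. cmod z = 1 \<Longrightarrow> \<bar>k z\<bar> \<le> 1" for k
  proof -
    \<comment> \<open>The affine change moves values from [-1, 1] into [0, 1]; the added constant
      contributes \<open>V 1 1\<close> to both sides and cancels.\<close>
    have "V (real_calc (\<lambda>z. (1/2) * (k z + 1))) 1 = V 1 (real_calc (\<lambda>z. (1/2) * (k z + 1)))"
    proof (rule real_calc_zero_product_balanced[OF V zero])
      show "0 \<le> (1/2) * (k z + 1) \<and> (1/2) * (k z + 1) \<le> 1" if "cmod z = 1" for z
        using k[OF that] by auto
    qed (auto intro!: continuous_intros contk)
    also have "real_calc (\<lambda>z. (1/2) * (k z + 1)) = (1/2) *\<^sub>R (real_calc k + 1)"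
      by (simp only: real_calc_scaleR real_calc_add real_calc_const contk continuous_on_add
          continuous_on_const scaleR_one)
    finally show ?thesis
      by (simp add: V.scaleR_left V.scaleR_right V.add_left V.add_right)
  qed
  define x y where "x = real_calc Re" and "y = real_calc Im"
  have "u = calc (\<lambda>z. of_real (Re z) + \<i> * of_real (Im z))"
    by (simp add: calc_id flip: complex_eq)
  also have "\<dots> = x + scaleC \<i> y"
    by (simp add: x_def y_def real_calc_def calc_add calc_mult calc_const scaleC_mult_left continuous_intros)
  finally have u: "u = x + scaleC \<i> y" .
  have "V x 1 = V 1 x"
    unfolding x_def by (rule part) (auto intro!: continuous_intros simp: abs_Re_le_cmod[THEN order_trans])
  moreover have "V y 1 = V 1 y"
    unfolding y_def by (rule part) (auto intro!: continuous_intros simp: abs_Im_le_cmod[THEN order_trans])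
  ultimately show ?thesis
    unfolding u V.add_left V.add_right left right by simp
qed

end

section \<open>From unitaries to all elements\<close>

lemma adj_exp: "adj (exp x) = exp (adj x)" for x :: "'a::cstar_algebra"
proof -
  have "(\<lambda>n. adj (x ^ n /\<^sub>R fact n)) sums adj (exp x)"
    by (rule bounded_linear.sums[OF bounded_linear_adj exp_converges])
  moreover have "adj (x ^ n /\<^sub>R fact n) = adj x ^ n /\<^sub>R fact n" for n
    by (simp add: linear_simps(5)[OF bounded_linear_adj] adj_power)
  ultimately show ?thesis
    using sums_unique2[OF _ exp_converges[of "adj x"]] by simp
qed

lemma unitary_element_exp:
  fixes x :: "'a::cstar_algebra"
  assumes "adj x = - x"
  shows "unitary_element (exp x)"
  by unfold_locales (simp_all add: adj_exp assms exp_minus_inverse exp_minus_inverse[of "- x", simplified])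

lemma zero_product_balanced:
  fixes V :: "'a::cstar_algebra \<Rightarrow> 'a \<Rightarrow> 'b::cstar_algebra"
  assumes V: "bounded_bilinear V"
    and zero: "\<And>x y. x * y = 0 \<Longrightarrow> V x y = 0"
    and left: "\<And>c x y. V (scaleC c x) y = scaleC c (V x y)"
    and right: "\<And>c x y. V x (scaleC c y) = scaleC c (V x y)"
  shows "V b 1 = V 1 b"
proof -
  interpret V: bounded_bilinear V by fact
  let ?T = "\<lambda>b. V b 1 - V 1 b"
  have T: "bounded_linear ?T"
    by (intro bounded_linear_sub V.bounded_linear_left V.bounded_linear_right)
  have skew: "?T x = 0" if x: "adj x = - x" for x
  proof -
    have "?T (exp (t *\<^sub>R x)) = 0" for t :: real
    proof -
      have "adj (t *\<^sub>R x) = - (t *\<^sub>R x)"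
        by (simp add: linear_simps(5)[OF bounded_linear_adj] x)
      then interpret unitary_element "exp (t *\<^sub>R x)" by (rule unitary_element_exp)
      show ?thesis using zero_product_balanced_unitary[OF V zero left right] by simp
    qed
    moreover have "((\<lambda>t. ?T (exp (t *\<^sub>R x))) has_vector_derivative ?T (exp (0 *\<^sub>R x) * x)) (at 0)"
      by (rule bounded_linear.has_vector_derivative[OF T exp_scaleR_has_vector_derivative_right])
    \<comment> \<open>\<open>?T\<close> vanishes along the whole curve of unitaries, so its
      derivative \<open>?T x\<close> at 0 must be that of the zero function.\<close>
    ultimately have "((\<lambda>t::real. 0) has_vector_derivative ?T x) (at 0)" by simp
    then show ?thesis
      using vector_derivative_unique_at[OF has_vector_derivative_const] by metis
  qed
  \<comment> \<open>The Cartesian decomposition with both parts skew-adjoint: \<open>y\<close> is i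
    times the self-adjoint part, so b = x - i y.\<close>
  define x where "x = (1/2) *\<^sub>R (b - adj b)"
  define y where "y = scaleC \<i> ((1/2) *\<^sub>R (b + adj b))"
  note adj = linear_simps[OF bounded_linear_adj]
  have "adj x = - x" by (simp add: x_def adj adj_adj algebra_simps)
  moreover have "adj y = - y"
    by (simp add: y_def adj adj_adj adj_scaleC add.commute scaleC_minus_left)
  moreover have "b = x + scaleC (- \<i>) y"
    by (simp add: x_def y_def scaleC_scaleC scaleC_one flip: scaleR_add_right)
  ultimately show ?thesis
    using skew[of x] skew[of y] by (simp add: V.add_left V.add_right left right)
qed

section \<open>The homomorphism\<close>

lemma bounded_linear_of_bounded_clinear_map:
  assumes "bounded_clinear_map f" shows "bounded_linear f"
proof -
  obtain K where "\<And>x. norm (f x) \<le> norm x * K"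
    using assms unfolding bounded_clinear_map_def by blast
  then show ?thesis
    using assms by (intro bounded_linear_intro[where K = K]) (auto simp: bounded_clinear_map_def scaleR_scaleC)
qed

lemma zero_product_middle:
  fixes \<phi> \<psi> :: "'a::cstar_algebra \<Rightarrow> 'b::cstar_algebra"
  assumes \<phi>: "bounded_clinear_map \<phi>" and \<psi>: "bounded_clinear_map \<psi>"
    and zero: "\<And>a b. a * b = 0 \<Longrightarrow> \<phi> a * \<psi> b = 0"
  shows "\<phi> (a * b) * \<psi> c = \<phi> a * \<psi> (b * c)"
proof -
  have *: "bounded_linear (\<lambda>x. \<phi> (a * x))" "bounded_linear (\<lambda>y. \<psi> (y * c))"
    using \<phi> \<psi> bounded_linear_compose[OF bounded_linear_of_bounded_clinear_map]
      bounded_linear_mult_left bounded_linear_mult_right by blast+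
  have "\<phi> (a * b) * \<psi> (1 * c) = \<phi> (a * 1) * \<psi> (b * c)"
  proof (rule zero_product_balanced[of "\<lambda>x y. \<phi> (a * x) * \<psi> (y * c)"])
    show "bounded_bilinear (\<lambda>x y. \<phi> (a * x) * \<psi> (y * c))"
      by (rule bounded_bilinear.comp[OF bounded_bilinear_mult *])
    show "\<phi> (a * x) * \<psi> (y * c) = 0" if "x * y = 0" for x y
    proof (rule zero)
      have "a * x * (y * c) = a * (x * y) * c" by (simp add: mult.assoc)
      then show "a * x * (y * c) = 0" using that by simp
    qed
  qed (use \<phi> \<psi> in \<open>simp_all add: bounded_clinear_map_def scaleC_mult_left scaleC_mult_right\<close>)
  then show ?thesis by simp
qed

theorem mainTheorem15:
  fixes \<phi> \<psi> :: "'a::cstar_algebra \<Rightarrow> 'b::cstar_algebra"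
  assumes "dedekind_finite TYPE('b)"
    and "bounded_clinear_map \<phi>" and "bounded_clinear_map \<psi>"
    and "\<And>a b. a * b = 0 \<Longrightarrow> \<phi> a * \<psi> b = 0"
    and "\<exists>a. invertible_elem (\<phi> a)"
    and "\<exists>a. invertible_elem (\<psi> a)"
  shows "\<exists>\<rho>::'a \<Rightarrow> 'b. algebra_hom \<rho> \<and>
           (\<forall>a. \<phi> a = \<phi> 1 * \<rho> a) \<and> (\<forall>a. \<psi> a = \<rho> a * \<psi> 1)"
proof -
  note mid = zero_product_middle[OF assms(2-4)]
  have finite: "y * x = 1" if "x * y = 1" for x y :: 'b
    using assms(1) that unfolding dedekind_finite_def by blast
  obtain a b s t where s: "\<phi> a * s = 1" "s * \<phi> a = 1" and t: "\<psi> b * t = 1" "t * \<psi> b = 1"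
    using assms(5,6) unfolding invertible_elem_def by blast
  \<comment> \<open>By \<open>mid\<close> the left side is \<phi> a * \<psi> b * t * s, where
    \<open>t\<close> cancels \<psi> b and then \<open>s\<close> cancels \<phi> a. Finiteness turns
    the right inverse into a two-sided one; for \<psi> 1 the same product is cancelled from the
    left.\<close>
  have "\<phi> 1 * (\<psi> (a * b) * (t * s)) = 1"
    using mid[of 1 a b] by (metis mult.assoc mult_1_left mult_1_right s t)
  then obtain p where p: "\<phi> 1 * p = 1" "p * \<phi> 1 = 1" using finite by blast
  have "(t * s * \<phi> (a * b)) * \<psi> 1 = 1"
    using mid[of a b 1] by (metis mult.assoc mult_1_left mult_1_right s t)
  then obtain q where q: "\<psi> 1 * q = 1" "q * \<psi> 1 = 1" using finite by blast
  define \<rho> where "\<rho> x = p * \<phi> x" for x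
  have \<phi>: "\<phi> x = \<phi> 1 * \<rho> x" for x
    by (simp add: \<rho>_def p flip: mult.assoc)
  have \<psi>: "\<psi> x = \<rho> x * \<psi> 1" for x
    using mid[of 1 x 1] p by (simp add: \<rho>_def mult.assoc) (metis mult.assoc mult_1_left)
  \<comment> \<open>Checked after multiplication by the invertible \<psi> 1 on the right, where
    \<open>mid\<close> can move \<open>y\<close> from \<phi> to \<psi>.\<close>
  have "\<rho> (x * y) = \<rho> x * \<rho> y" for x y
  proof -
    have "\<rho> (x * y) * \<psi> 1 = p * (\<phi> x * \<psi> y)"
      using mid[of x y 1] by (simp add: \<rho>_def mult.assoc)
    also have "\<dots> = \<rho> x * \<rho> y * \<psi> 1"
      using \<psi>[of y] by (simp add: \<rho>_def mult.assoc)
    finally show ?thesis by (metis mult.assoc mult_1_right q(1))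
  qed
  then have "algebra_hom \<rho>"
    using assms(2) by (simp add: algebra_hom_def \<rho>_def bounded_clinear_map_def distrib_left scaleC_mult_right)
  with \<phi> \<psi> show ?thesis by blast
qed

end
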